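(* Let $G_1=(V,E_1)$, $G_2=(V,E_2)$, and $G_3=(V,E_3)$ be planar graphs with shared vertex set $V$. Let $G_1\setminus G_3=(V,E_1\setminus E_3)$ and $G_2\setminus G_3=(V,E_2\setminus E_3)$. If $\langle G_1\setminus G_3,G_2\setminus G_3\rangle$ admits a SEFE, then $\langle G_1,G_2,G_3\rangle$ admits a QuaSEFE in which the drawing of $G_3$ is planar.
   Context: Drawings are topological: vertices are distinct points of the plane and edges are curves joining their endpoints. A drawing is quasiplanar if no three of its edges pairwise cross. Given graphs $G_1=(V,E_1),\ldots,G_k=(V,E_k)$ on a shared vertex set $V$, the tuple $\langle G_1,\ldots,G_k\rangle$ admits a QuaSEFE if there are quasiplanar drawings $\Gamma_1,\ldots,\Gamma_k$ of $G_1,\ldots,G_k$ such that each vertex of $V$ has the same position in every $\Gamma_i$ and each edge shared by $G_i$ and $G_j$ is drawn as the same curve in $\Gamma_i$ and $\Gamma_j$. A SEFE (simultaneous embedding with fixed edges) of $\langle G_1,\ldots,G_k\rangle$ is defined in the same way but requiring each $\Gamma_i$ to be planar (crossing-free). *)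

theory Defs
  imports "HOL-Analysis.Analysis"
begin

text \<open>A graph is given by its vertex set and its set of edges, each edge being the
  set of its two endpoints.\<close>

definition finite_simple_graph :: "'a set \<Rightarrow> 'a set set \<Rightarrow> bool" where
  "finite_simple_graph V E \<longleftrightarrow> finite V \<and> (\<forall>e\<in>E. e \<subseteq> V \<and> card e = 2)"

text \<open>The curve of an edge is recorded as a point set, so that two edges are drawn as the same
  curve regardless of parametrisation. Values outside \<open>V\<close> and \<open>E\<close> are irrelevant.\<close>

record 'a drawing =
  pos :: "'a \<Rightarrow> real ^ 2"
  curve :: "'a set \<Rightarrow> (real ^ 2) set"

definition arc_joining :: "(real ^ 2) set \<Rightarrow> (real ^ 2) set \<Rightarrow> bool" where
  "arc_joining C P \<longleftrightarrow>
     (\<exists>g. arc g \<and> path_image g = C \<and> {pathstart g, pathfinish g} = P)"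

text \<open>As usual, an edge meets the positions of vertices only in its own two endpoints.
  Edges may otherwise intersect each other arbitrarily.\<close>

definition is_drawing :: "'a set \<Rightarrow> 'a set set \<Rightarrow> 'a drawing \<Rightarrow> bool" where
  "is_drawing V E \<Gamma> \<longleftrightarrow>
     inj_on (pos \<Gamma>) V \<and>
     (\<forall>e\<in>E. arc_joining (curve \<Gamma> e) (pos \<Gamma> ` e) \<and>
            curve \<Gamma> e \<inter> pos \<Gamma> ` V = pos \<Gamma> ` e)"

text \<open>Two distinct edges cross if they have a common interior point; touching points thus
  count as crossings, common endpoints do not.\<close>

definition crosses :: "'a drawing \<Rightarrow> 'a set \<Rightarrow> 'a set \<Rightarrow> bool" where
  "crosses \<Gamma> e f \<longleftrightarrow>
     e \<noteq> f \<and> (curve \<Gamma> e - pos \<Gamma> ` e) \<inter> (curve \<Gamma> f - pos \<Gamma> ` f) \<noteq> {}"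

definition planar_drawing :: "'a set \<Rightarrow> 'a set set \<Rightarrow> 'a drawing \<Rightarrow> bool" where
  "planar_drawing V E \<Gamma> \<longleftrightarrow>
     is_drawing V E \<Gamma> \<and> (\<forall>e\<in>E. \<forall>f\<in>E. \<not> crosses \<Gamma> e f)"

definition quasiplanar_drawing :: "'a set \<Rightarrow> 'a set set \<Rightarrow> 'a drawing \<Rightarrow> bool" where
  "quasiplanar_drawing V E \<Gamma> \<longleftrightarrow>
     is_drawing V E \<Gamma> \<and>
     \<not> (\<exists>e\<in>E. \<exists>f\<in>E. \<exists>h\<in>E. crosses \<Gamma> e f \<and> crosses \<Gamma> f h \<and> crosses \<Gamma> e h)"

definition planar_graph :: "'a set \<Rightarrow> 'a set set \<Rightarrow> bool" where
  "planar_graph V E \<longleftrightarrow> finite_simple_graph V E \<and> (\<exists>\<Gamma>. planar_drawing V E \<Gamma>)"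

text \<open>A tuple of graphs on the shared vertex set \<open>V\<close> is the list \<open>Es\<close> of their edge sets.\<close>

definition compatible_drawings :: "'a set \<Rightarrow> 'a set set list \<Rightarrow> 'a drawing list \<Rightarrow> bool" where
  "compatible_drawings V Es \<Gamma>s \<longleftrightarrow>
     length \<Gamma>s = length Es \<and>
     (\<forall>i<length Es. \<forall>j<length Es.
        (\<forall>v\<in>V. pos (\<Gamma>s ! i) v = pos (\<Gamma>s ! j) v) \<and>
        (\<forall>e\<in>Es ! i \<inter> Es ! j. curve (\<Gamma>s ! i) e = curve (\<Gamma>s ! j) e))"

definition is_SEFE :: "'a set \<Rightarrow> 'a set set list \<Rightarrow> 'a drawing list \<Rightarrow> bool" where
  "is_SEFE V Es \<Gamma>s \<longleftrightarrow>
     compatible_drawings V Es \<Gamma>s \<and>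
     (\<forall>i<length Es. planar_drawing V (Es ! i) (\<Gamma>s ! i))"

definition is_QuaSEFE :: "'a set \<Rightarrow> 'a set set list \<Rightarrow> 'a drawing list \<Rightarrow> bool" where
  "is_QuaSEFE V Es \<Gamma>s \<longleftrightarrow>
     compatible_drawings V Es \<Gamma>s \<and>
     (\<forall>i<length Es. quasiplanar_drawing V (Es ! i) (\<Gamma>s ! i))"

definition admits_SEFE :: "'a set \<Rightarrow> 'a set set list \<Rightarrow> bool" where
  "admits_SEFE V Es \<longleftrightarrow> (\<exists>\<Gamma>s. is_SEFE V Es \<Gamma>s)"

end

theory Submission imports Defs begin

text \<open>Any finite set of points of the plane can be moved to any other of the same size by a
  homeomorphism of the plane, so the planar graph \<open>(V, E3)\<close> has a planar drawing on the vertex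
  positions prescribed by the SEFE. Then each of \<open>E1\<close> and \<open>E2\<close> splits into two crossing-free
  parts, and among three edges two lie in the same part.\<close>

lemma homeomorphism_plane_obtain:
  fixes p q :: "'a \<Rightarrow> real ^ 2"
  assumes "finite V" "inj_on p V" "inj_on q V"
  obtains f :: "real ^ 2 \<Rightarrow> real ^ 2"
  where "continuous_on UNIV f" "inj f" "\<And>v. v \<in> V \<Longrightarrow> f (p v) = q v"
proof -
  have "pairwise (\<lambda>i j. p i \<noteq> p j \<and> q i \<noteq> q j) V"
    using assms(2,3) by (auto simp: pairwise_def inj_on_def)
  \<comment> \<open>The plane has dimension 2, which is what lets points be moved past each other;
    on a line their order would be an obstruction.\<close>
  then obtain f g where "homeomorphism UNIV UNIV f g" "\<And>v. v \<in> V \<Longrightarrow> f (p v) = q v"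
    by (rule homeomorphism_moving_points_exists
        [where S = UNIV and T = UNIV and x = p and y = q, rotated 6]) (auto simp: assms(1))
  \<comment> \<open>Injectivity comes from the inverse \<open>g\<close>. Together with continuity it
    suffices to transport arcs, incidences and crossings.\<close>
  then show ?thesis
    using that[of f] unfolding homeomorphism_def by (metis UNIV_I injI)
qed

text \<open>Composing a parametrisation with \<open>f\<close> stays continuous, and injectivity of
  \<open>f\<close> keeps it free of repeated points.\<close>

lemma arc_joining_image:
  assumes "arc_joining C P" "continuous_on UNIV f" "inj f"
  shows "arc_joining (f ` C) (f ` P)"
proof -
  obtain g where g: "arc g" "path_image g = C" "{pathstart g, pathfinish g} = P"
    using assms(1) unfolding arc_joining_def by blast
  have "arc (f \<circ> g)"
    using g(1) assms(2,3) unfolding arc_def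
    by (meson comp_inj_on continuous_on_subset inj_on_subset path_continuous_image subset_UNIV)
  moreover have "path_image (f \<circ> g) = f ` C"
    using g(2) by (simp add: path_image_compose)
  moreover have "{pathstart (f \<circ> g), pathfinish (f \<circ> g)} = f ` P"
    using g(3) by (auto simp: pathstart_compose pathfinish_compose)
  ultimately show ?thesis unfolding arc_joining_def by blast
qed

lemma planar_drawing_at_positions:
  assumes "planar_graph V E" "inj_on p V"
  obtains \<Gamma> where "planar_drawing V E \<Gamma>" "pos \<Gamma> = p"
proof -
  obtain \<Delta> where "planar_drawing V E \<Delta>" "finite V" and EV: "\<And>e. e \<in> E \<Longrightarrow> e \<subseteq> V"
    using assms(1) unfolding planar_graph_def finite_simple_graph_def by blast
  then have inj: "inj_on (pos \<Delta>) V"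
    and arcs: "\<And>e. e \<in> E \<Longrightarrow> arc_joining (curve \<Delta> e) (pos \<Delta> ` e)"
    and avoid: "\<And>e. e \<in> E \<Longrightarrow> curve \<Delta> e \<inter> pos \<Delta> ` V = pos \<Delta> ` e"
    and nocross: "\<And>e e'. e \<in> E \<Longrightarrow> e' \<in> E \<Longrightarrow> \<not> crosses \<Delta> e e'"
    unfolding planar_drawing_def is_drawing_def by blast+
  obtain f where f: "continuous_on UNIV f" "inj f" "\<And>v. v \<in> V \<Longrightarrow> f (pos \<Delta> v) = p v"
    using homeomorphism_plane_obtain[OF \<open>finite V\<close> inj assms(2)] by blast
  \<comment> \<open>Positions are \<open>p\<close> itself and not
    \<open>f \<circ> pos \<Delta>\<close>: the two agree on \<open>V\<close>, where all endpoints
    lie, and the equation \<open>pos \<Gamma> = p\<close> then holds between total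
    functions.\<close>
  define \<Gamma> where "\<Gamma> = \<lparr>pos = p, curve = \<lambda>e. f ` curve \<Delta> e\<rparr>"
  have im: "p ` W = f ` pos \<Delta> ` W" if "W \<subseteq> V" for W
    using that f(3) by (force simp: image_image)
  have "arc_joining (curve \<Gamma> e) (pos \<Gamma> ` e)" if "e \<in> E" for e
    using arc_joining_image[OF arcs[OF that] f(1,2)] im[OF EV[OF that]] by (simp add: \<Gamma>_def)
  \<comment> \<open>An injective \<open>f\<close> commutes with intersection and difference of sets,
    so here and for crossings every condition on \<open>\<Gamma>\<close> is the image of the one on
    \<open>\<Delta>\<close>.\<close>
  moreover have "curve \<Gamma> e \<inter> pos \<Gamma> ` V = pos \<Gamma> ` e" if "e \<in> E" for e
    using avoid[OF that] im[OF EV[OF that]] im[of V]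
    by (simp add: \<Gamma>_def image_Int[OF f(2), symmetric])
  moreover have "\<not> crosses \<Gamma> e e'" if "e \<in> E" "e' \<in> E" for e e'
    using nocross[OF that] im[OF EV[OF that(1)]] im[OF EV[OF that(2)]]
    by (simp add: \<Gamma>_def crosses_def image_Int[OF f(2), symmetric]
        image_set_diff[OF f(2), symmetric])
  ultimately have "planar_drawing V E \<Gamma>"
    using assms(2) by (simp add: planar_drawing_def is_drawing_def \<Gamma>_def)
  then show ?thesis by (rule that) (simp add: \<Gamma>_def)
qed

definition overlay :: "'a set set \<Rightarrow> 'a drawing \<Rightarrow> 'a drawing \<Rightarrow> 'a drawing" where
  "overlay E \<Gamma> \<Delta> = \<lparr>pos = pos \<Gamma>, curve = \<lambda>e. if e \<in> E then curve \<Gamma> e else curve \<Delta> e\<rparr>"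

text \<open>Crossings within \<open>F\<close> occur only between \<open>F \<inter> E\<close> and
  \<open>F - E\<close>, so the crossing relation is bipartite and has no triangle.\<close>

lemma quasiplanar_overlay:
  assumes "planar_drawing V E \<Gamma>" "planar_drawing V (F - E) \<Delta>"
    and pos: "\<And>v. v \<in> V \<Longrightarrow> pos \<Gamma> v = pos \<Delta> v"
    and FV: "\<And>e. e \<in> F \<Longrightarrow> e \<subseteq> V"
  shows "quasiplanar_drawing V F (overlay E \<Gamma> \<Delta>)"
proof -
  have im: "pos \<Gamma> ` W = pos \<Delta> ` W" if "W \<subseteq> V" for W
    using that pos by (intro image_cong) auto
  have "is_drawing V F (overlay E \<Gamma> \<Delta>)"
    using assms(1,2) im FV
    by (auto simp: planar_drawing_def is_drawing_def overlay_def)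
  moreover have "crosses (overlay E \<Gamma> \<Delta>) e f \<longleftrightarrow> crosses \<Gamma> e f" if "e \<in> E" "f \<in> E" for e f
    using that by (simp add: crosses_def overlay_def)
  \<comment> \<open>The overlay removes endpoints at the positions of \<open>\<Gamma>\<close>, while
    \<open>\<Delta>\<close> uses its own; both agree because edges of \<open>F\<close> lie in
    \<open>V\<close>.\<close>
  moreover have "crosses (overlay E \<Gamma> \<Delta>) e f \<longleftrightarrow> crosses \<Delta> e f"
    if "e \<in> F - E" "f \<in> F - E" for e f
    using that im[OF FV] by (simp add: crosses_def overlay_def)
  ultimately have "\<not> crosses (overlay E \<Gamma> \<Delta>) e f"
    if "e \<in> F" "f \<in> F" "e \<in> E \<longleftrightarrow> f \<in> E" for e f
    using assms(1,2) that by (auto simp: planar_drawing_def)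
  then show ?thesis
    using \<open>is_drawing V F (overlay E \<Gamma> \<Delta>)\<close>
    unfolding quasiplanar_drawing_def by blast
qed

lemma planar_imp_quasiplanar: "planar_drawing V E \<Gamma> \<Longrightarrow> quasiplanar_drawing V E \<Gamma>"
  by (auto simp: planar_drawing_def quasiplanar_drawing_def)

theorem theorem1:
  fixes V :: "'a set" and E1 E2 E3 :: "'a set set"
  assumes "planar_graph V E1"
    and "planar_graph V E2"
    and "planar_graph V E3"
    and "admits_SEFE V [E1 - E3, E2 - E3]"
  shows "\<exists>\<Gamma>1 \<Gamma>2 \<Gamma>3. is_QuaSEFE V [E1, E2, E3] [\<Gamma>1, \<Gamma>2, \<Gamma>3] \<and> planar_drawing V E3 \<Gamma>3"
proof -
  obtain \<Gamma>s where sefe: "is_SEFE V [E1 - E3, E2 - E3] \<Gamma>s"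
    using assms(4) unfolding admits_SEFE_def by blast
  then obtain \<Delta>1 \<Delta>2 where "\<Gamma>s = [\<Delta>1, \<Delta>2]"
    by (auto simp: is_SEFE_def compatible_drawings_def length_Suc_conv)
  with sefe have compat: "compatible_drawings V [E1 - E3, E2 - E3] [\<Delta>1, \<Delta>2]"
    and planar: "\<forall>i<2. planar_drawing V ([E1 - E3, E2 - E3] ! i) ([\<Delta>1, \<Delta>2] ! i)"
    by (auto simp: is_SEFE_def numeral_2_eq_2)
  have pl: "planar_drawing V (E1 - E3) \<Delta>1" "planar_drawing V (E2 - E3) \<Delta>2"
    using planar[rule_format, of 0] planar[rule_format, of 1] by auto
  have "(\<forall>v\<in>V. pos \<Delta>1 v = pos \<Delta>2 v) \<and>
      (\<forall>e\<in>(E1 - E3) \<inter> (E2 - E3). curve \<Delta>1 e = curve \<Delta>2 e)"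
    using compat[unfolded compatible_drawings_def, THEN conjunct2, rule_format, of 0 1] by simp
  then have pos: "\<And>v. v \<in> V \<Longrightarrow> pos \<Delta>1 v = pos \<Delta>2 v"
    and shared: "\<And>e. e \<in> E1 \<Longrightarrow> e \<in> E2 \<Longrightarrow> e \<notin> E3 \<Longrightarrow> curve \<Delta>1 e = curve \<Delta>2 e"
    by blast+
  have "inj_on (pos \<Delta>1) V"
    using pl(1) by (simp add: planar_drawing_def is_drawing_def)
  \<comment> \<open>As \<open>\<Delta>1\<close> and \<open>\<Delta>2\<close> agree on
    \<open>V\<close>, a drawing at the positions of \<open>\<Delta>1\<close> fits both.\<close>
  then obtain \<Gamma> where \<Gamma>: "planar_drawing V E3 \<Gamma>" "pos \<Gamma> = pos \<Delta>1"
    using planar_drawing_at_positions assms(3) by blast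
  have sub: "\<And>e. e \<in> E1 \<Longrightarrow> e \<subseteq> V" "\<And>e. e \<in> E2 \<Longrightarrow> e \<subseteq> V"
    using assms(1,2) by (auto simp: planar_graph_def finite_simple_graph_def)
  have "quasiplanar_drawing V E1 (overlay E3 \<Gamma> \<Delta>1)"
    using \<Gamma> pl(1) sub by (intro quasiplanar_overlay) auto
  moreover have "quasiplanar_drawing V E2 (overlay E3 \<Gamma> \<Delta>2)"
    using \<Gamma> pl(2) sub pos by (intro quasiplanar_overlay) auto
  \<comment> \<open>A shared edge in \<open>E3\<close> is drawn by \<open>\<Gamma>\<close>
    everywhere. A shared edge outside \<open>E3\<close> can only be common to \<open>E1\<close> and
    \<open>E2\<close>, where the SEFE provides equal curves.\<close>
  moreover have "compatible_drawings V [E1, E2, E3] [overlay E3 \<Gamma> \<Delta>1, overlay E3 \<Gamma> \<Delta>2, \<Gamma>]"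
    using shared \<Gamma>(2) pos by (simp add: compatible_drawings_def overlay_def All_less_Suc)
  ultimately have "is_QuaSEFE V [E1, E2, E3] [overlay E3 \<Gamma> \<Delta>1, overlay E3 \<Gamma> \<Delta>2, \<Gamma>]"
    using planar_imp_quasiplanar[OF \<Gamma>(1)] by (simp add: is_QuaSEFE_def All_less_Suc)
  then show ?thesis using \<Gamma>(1) by blast
qed

end
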